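(* For every irrational $\alpha\in\mathbb{T}$ there exists a continuous function $\varphi:\mathbb{T}\to\mathbb{R}$ such that the cylindrical transformation $T_\varphi:\mathbb{T}\times\mathbb{R}\to\mathbb{T}\times\mathbb{R}$, $T_\varphi(x,t)=(x+\alpha,t+\varphi(x))$, is Besicovitch.
   Context: $\mathbb{T}=\mathbb{R}/\mathbb{Z}$. For $T x=x+\alpha$ and $n\in\mathbb{Z}$, $\varphi^{(n)}$ is defined by $T_\varphi^n(x,t)=(T^nx,t+\varphi^{(n)}(x))$, i.e. $\varphi^{(n)}(x)=\sum_{k=0}^{n-1}\varphi(T^kx)$ for $n>0$, $\varphi^{(0)}=0$, and $\varphi^{(n)}(x)=-\sum_{k=1}^{|n|}\varphi(T^{-k}x)$ for $n<0$. The orbit of $(x,t)$ under $T_\varphi$ is called discrete if $|\varphi^{(n)}(x)|\to+\infty$ as $|n|\to+\infty$. $T_\varphi$ is called Besicovitch if it has both a dense (two-sided) orbit and a discrete orbit. *)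

theory Defs
  imports "HOL-Analysis.Analysis"
begin

quotient_type circle = real / "\<lambda>x y. x - y \<in> (\<int> :: real set)"
  morphisms rep_circle to_circle
proof (rule equivpI)
  show "reflp (\<lambda>x y. x - y \<in> (\<int> :: real set))"
    by (rule reflpI) simp
  show "symp (\<lambda>x y. x - y \<in> (\<int> :: real set))"
    by (rule sympI) (metis Ints_minus minus_diff_eq)
  show "transp (\<lambda>x y. x - y \<in> (\<int> :: real set))"
    by (rule transpI) (metis Ints_add diff_add_cancel add_diff_eq)
qed

instantiation circle :: ab_group_add
begin

lift_definition zero_circle :: circle is "0 :: real" .

lift_definition plus_circle :: "circle \<Rightarrow> circle \<Rightarrow> circle" is "(+)"
  by (metis Ints_add add_diff_add)

lift_definition uminus_circle :: "circle \<Rightarrow> circle" is "uminus"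
  by (metis Ints_minus minus_diff_minus)

lift_definition minus_circle :: "circle \<Rightarrow> circle \<Rightarrow> circle" is "(-)"
proof -
  fix a b c d :: real
  assume "a - b \<in> \<int>" "c - d \<in> \<int>"
  then have "(a - b) - (c - d) \<in> \<int>" by (rule Ints_diff)
  then show "(a - c) - (b - d) \<in> \<int>" by (simp add: algebra_simps)
qed

instance
  by standard (transfer; simp add: algebra_simps)+

end

instantiation circle :: topological_space
begin

definition open_circle :: "circle set \<Rightarrow> bool"
  where "open_circle U \<longleftrightarrow> open (to_circle -` U)"

instance
  by standard (auto simp: open_circle_def vimage_Union)

end

definition irrational_circle :: "circle \<Rightarrow> bool"
  where "irrational_circle \<alpha> \<longleftrightarrow> \<alpha> \<notin> to_circle ` \<rat>"

text \<open>Only meaningful for bijective \<open>f\<close>.\<close>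

definition iterate :: "('a \<Rightarrow> 'a) \<Rightarrow> int \<Rightarrow> 'a \<Rightarrow> 'a"
  where "iterate f n = (if n \<ge> 0 then f ^^ nat n else inv f ^^ nat (- n))"

definition rotation :: "circle \<Rightarrow> circle \<Rightarrow> circle"
  where "rotation \<alpha> x = x + \<alpha>"

definition cylindrical :: "circle \<Rightarrow> (circle \<Rightarrow> real) \<Rightarrow> circle \<times> real \<Rightarrow> circle \<times> real"
  where "cylindrical \<alpha> \<phi> = (\<lambda>(x, t). (x + \<alpha>, t + \<phi> x))"

definition cocycle :: "circle \<Rightarrow> (circle \<Rightarrow> real) \<Rightarrow> int \<Rightarrow> circle \<Rightarrow> real"
  where "cocycle \<alpha> \<phi> n x =
    (if n \<ge> 0 then \<Sum>k = 0..<n. \<phi> (iterate (rotation \<alpha>) k x)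
     else - (\<Sum>k = 1..\<bar>n\<bar>. \<phi> (iterate (rotation \<alpha>) (- k) x)))"

definition orbit :: "('a \<Rightarrow> 'a) \<Rightarrow> 'a \<Rightarrow> 'a set"
  where "orbit f p = range (\<lambda>n. iterate f n p)"

definition discrete_orbit :: "circle \<Rightarrow> (circle \<Rightarrow> real) \<Rightarrow> circle \<times> real \<Rightarrow> bool"
  where "discrete_orbit \<alpha> \<phi> p \<longleftrightarrow>
    filterlim (\<lambda>n. \<bar>cocycle \<alpha> \<phi> n (fst p)\<bar>) at_top (filtercomap (\<lambda>n. \<bar>n\<bar>) at_top)"

definition besicovitch :: "circle \<Rightarrow> (circle \<Rightarrow> real) \<Rightarrow> bool"
  where "besicovitch \<alpha> \<phi> \<longleftrightarrow>
    (\<exists>p. closure (orbit (cylindrical \<alpha> \<phi>) p) = UNIV) \<and> (\<exists>p. discrete_orbit \<alpha> \<phi> p)"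

lemma inv_rotation: "inv (rotation \<alpha>) = (\<lambda>x. x - \<alpha>)"
  by (rule inv_equality) (simp_all add: rotation_def)

lemma inv_cylindrical: "inv (cylindrical \<alpha> \<phi>) = (\<lambda>(x, t). (x - \<alpha>, t - \<phi> (x - \<alpha>)))"
  by (rule inv_equality) (auto simp: cylindrical_def)

lemma bij_cylindrical: "bij (cylindrical \<alpha> \<phi>)"
  by (rule bij_betw_byWitness[where f' = "\<lambda>(x, t). (x - \<alpha>, t - \<phi> (x - \<alpha>))"])
    (auto simp: cylindrical_def)

text \<open>The explicit sums agree with the definition through the iterates of the cylindrical map.\<close>

lemma iterate_cylindrical:
  "iterate (cylindrical \<alpha> \<phi>) n (x, t) = (iterate (rotation \<alpha>) n x, t + cocycle \<alpha> \<phi> n x)"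
proof (cases "n \<ge> 0")
  case True
  have "(cylindrical \<alpha> \<phi> ^^ m) (x, t) =
      ((rotation \<alpha> ^^ m) x, t + (\<Sum>k = 0..<int m. \<phi> (iterate (rotation \<alpha>) k x)))" for m
  proof (induction m)
    case (Suc m)
    have "{0..<int (Suc m)} = insert (int m) {0..<int m}" by auto
    with Suc show ?case
      by (simp add: cylindrical_def rotation_def iterate_def)
  qed simp
  from this[of "nat n"] True show ?thesis
    by (simp add: iterate_def cocycle_def)
next
  case False
  have "(inv (cylindrical \<alpha> \<phi>) ^^ m) (x, t) =
      ((inv (rotation \<alpha>) ^^ m) x, t - (\<Sum>k = 1..int m. \<phi> (iterate (rotation \<alpha>) (- k) x)))" for m
  proof (induction m)
    case (Suc m)
    have *: "{1..int (Suc m)} = insert (int (Suc m)) {1..int m}" by auto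
    have "iterate (rotation \<alpha>) (- int (Suc m)) x = (inv (rotation \<alpha>) ^^ m) x - \<alpha>"
      by (simp add: iterate_def inv_rotation nat_add_distrib)
    with Suc show ?case
      unfolding * by (simp add: inv_cylindrical inv_rotation del: of_nat_Suc)
  qed simp
  from this[of "nat (- n)"] False show ?thesis
    by (simp add: iterate_def cocycle_def)
qed

end

theory Submission
  imports Defs
begin

text \<open>Take \<open>\<phi>\<close> to be a uniformly convergent sum of coboundaries \<open>h\<^sub>k(x + a) - h\<^sub>k(x)\<close> of size at
  most \<open>2\<^sup>-\<^sup>k\<close>, where \<open>h\<^sub>k \<ge> 0\<close>, \<open>h\<^sub>k(0) = 0\<close> and \<open>h\<^sub>k(na) \<ge> k\<close> on the time window
  \<open>k 2\<^sup>k \<le> \<bar>n\<bar> \<le> (k+1) 2\<^sup>k\<^sup>+\<^sup>1\<close>. These windows cover \<open>\<int>\<close>, so \<open>\<phi>\<^sup>(\<^sup>n\<^sup>)(0) = \<Sum>\<^sub>k h\<^sub>k(na)\<close> tends to \<open>+\<infinity>\<close>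
  in both time directions and the orbit of \<open>0\<close> is discrete. The same one-sided divergence forces
  topological transitivity: \<open>\<phi>\<^sup>(\<^sup>n\<^sup>)\<close> is large at points \<open>pa\<close>, whereas at \<open>qa - na\<close> it equals
  \<open>- \<phi>\<^sup>(\<^sup>-\<^sup>n\<^sup>)(qa)\<close>, which is very negative; when these points are close, \<open>\<phi>\<^sup>(\<^sup>n\<^sup>)\<close> takes every
  moderate value between them. A dense orbit then exists by the Baire category theorem.\<close>

section \<open>The circle and its rotation, lifted to the real line\<close>

lemma to_circle_eq_iff: "to_circle x = to_circle y \<longleftrightarrow> x - y \<in> \<int>"
  by (simp add: circle.abs_eq_iff)

lemma to_circle_rep: "to_circle (rep_circle c) = c"
  by (metis Quotient_abs_rep Quotient_circle)

lemma to_circle_add: "to_circle x + to_circle y = to_circle (x + y)"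
  by (rule plus_circle.abs_eq)

lemma to_circle_diff: "to_circle x - to_circle y = to_circle (x - y)"
  by (rule minus_circle.abs_eq)

lemma to_circle_add_of_int [simp]: "to_circle (x + of_int i) = to_circle x"
  by (simp add: to_circle_eq_iff)

lemma irrational_circle_to_circle_iff: "irrational_circle (to_circle a) \<longleftrightarrow> a \<notin> \<rat>"
proof
  assume "irrational_circle (to_circle a)"
  then show "a \<notin> \<rat>" by (auto simp: irrational_circle_def)
next
  assume a: "a \<notin> \<rat>"
  { fix q assume "q \<in> \<rat>" "to_circle a = to_circle q"
    then have "a - q \<in> \<rat>" by (metis to_circle_eq_iff Ints_subset_Rats subsetD)
    with \<open>q \<in> \<rat>\<close> have "(a - q) + q \<in> \<rat>" by (rule Rats_add[rotated])
    with a have False by simp }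
  then show "irrational_circle (to_circle a)" by (auto simp: irrational_circle_def)
qed

text \<open>Lifts orbits to the reals: points are written \<open>to_circle x\<close> from here on,
  so that order, distance and connectedness of the line are available.\<close>

lemma iterate_rotation:
  "iterate (rotation (to_circle a)) n (to_circle x) = to_circle (x + of_int n * a)"
proof -
  have pos: "(rotation (to_circle a) ^^ m) (to_circle x) = to_circle (x + of_nat m * a)" for m
    by (induction m) (simp_all add: rotation_def to_circle_add algebra_simps)
  have neg: "(inv (rotation (to_circle a)) ^^ m) (to_circle x) = to_circle (x - of_nat m * a)" for m
    by (induction m) (simp_all add: inv_rotation to_circle_diff algebra_simps)
  show ?thesis by (simp add: iterate_def pos neg)
qed

section \<open>The cocycle identity and continuity of the cocycle\<close>

lemma cocycle_0 [simp]: "cocycle \<alpha> \<phi> 0 x = 0"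
  by (simp add: cocycle_def)

lemma cocycle_succ:
  "cocycle (to_circle a) \<phi> (n + 1) (to_circle x) =
    cocycle (to_circle a) \<phi> n (to_circle x) + \<phi> (to_circle (x + of_int n * a))"
proof (cases "n \<ge> 0")
  case True
  then have "{0..<n + 1} = insert n {0..<n}" by auto
  with True show ?thesis by (simp add: cocycle_def iterate_rotation)
next
  case False
  then have eq: "{1..\<bar>n\<bar>} = insert (- n) {1..\<bar>n + 1\<bar>}" by auto
  have "(\<Sum>k = 1..\<bar>n\<bar>. \<phi> (iterate (rotation (to_circle a)) (- k) (to_circle x))) =
      \<phi> (to_circle (x + of_int n * a)) +
      (\<Sum>k = 1..\<bar>n + 1\<bar>. \<phi> (iterate (rotation (to_circle a)) (- k) (to_circle x)))"
    unfolding eq using False by (subst sum.insert) (auto simp: iterate_rotation)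
  \<comment> \<open>At \<open>n = -1\<close> the successor is 0, which falls under the other branch
    of the definition, so this value is split off.\<close>
  with False show ?thesis by (cases "n = -1") (auto simp: cocycle_def)
qed

text \<open>The recurrence can be run in both directions from 0. This is how closed forms for the
  cocycle are verified without splitting on the sign of \<open>n\<close>.\<close>

lemma cocycle_unique:
  fixes c :: "int \<Rightarrow> real"
  assumes "c 0 = 0" "\<And>n. c (n + 1) = c n + \<phi> (to_circle (x + of_int n * a))"
  shows "cocycle (to_circle a) \<phi> n (to_circle x) = c n"
proof (induction n rule: int_induct[where k = 0])
  case (step2 i)
  from cocycle_succ[of a \<phi> "i - 1" x] assms(2)[of "i - 1"] step2 show ?case by simp
qed (simp_all add: assms cocycle_succ)

lemma cocycle_add:
  "cocycle (to_circle a) \<phi> (m + n) (to_circle x) =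
    cocycle (to_circle a) \<phi> m (to_circle x) +
    cocycle (to_circle a) \<phi> n (to_circle (x + of_int m * a))"
proof -
  have "cocycle (to_circle a) \<phi> n (to_circle (x + of_int m * a)) =
      cocycle (to_circle a) \<phi> (m + n) (to_circle x) - cocycle (to_circle a) \<phi> m (to_circle x)"
  proof (rule cocycle_unique)
    show "cocycle (to_circle a) \<phi> (m + (n + 1)) (to_circle x) -
        cocycle (to_circle a) \<phi> m (to_circle x) =
      cocycle (to_circle a) \<phi> (m + n) (to_circle x) - cocycle (to_circle a) \<phi> m (to_circle x) +
        \<phi> (to_circle (x + of_int m * a + of_int n * a))" for n
      using cocycle_succ[of a \<phi> "m + n" x] by (simp add: algebra_simps)
  qed simp
  then show ?thesis by simp
qed

lemma continuous_on_cocycle: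
  assumes "continuous_on UNIV (\<lambda>x. \<phi> (to_circle x))"
  shows "continuous_on UNIV (\<lambda>x. cocycle (to_circle a) \<phi> n (to_circle x))"
proof -
  have f: "continuous_on UNIV (\<lambda>x. \<phi> (to_circle (x + of_int n * a)))" for n
    by (rule continuous_on_compose2[OF assms]) (auto intro!: continuous_intros)
  show ?thesis
  proof (induction n rule: int_induct[where k = 0])
    case (step1 i)
    then show ?case by (simp add: cocycle_succ continuous_on_add f)
  next
    case (step2 i)
    have "cocycle (to_circle a) \<phi> (i - 1) (to_circle x) = cocycle (to_circle a) \<phi> i (to_circle x)
        - \<phi> (to_circle (x + of_int (i - 1) * a))" for x
      using cocycle_succ[of a \<phi> "i - 1" x] by simp
    with step2 show ?case by (simp add: continuous_on_diff f del: of_int_diff)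
  qed simp
qed

section \<open>Diophantine approximation\<close>

text \<open>An irrational has infinitely many approximants \<open>h / m\<close> with error below
  \<open>1 / m^2\<close>, so \<open>m\<close> may be taken beyond both \<open>K\<close> and
  \<open>1 / e\<close>; multiplying the error by \<open>m\<close> leaves less than
  \<open>1 / m < e\<close>.\<close>

lemma exists_large_return_time:
  fixes a :: real
  assumes "a \<notin> \<rat>" "e > 0"
  obtains h m where "m > K" "\<bar>of_int m * a - of_int h\<bar> < e"
proof -
  obtain h m where hm: "(h, m) \<in> approx_set a" "m > max K \<lceil>1 / e\<rceil>"
    using infinite_approx_set rational_iff_finite_approx_set assms(1) by blast
  then have m: "m > 0" and "\<bar>a - of_int h / of_int m\<bar> < 1 / (of_int m)\<^sup>2"
    by (auto simp: approx_set_def)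
  then have "of_int m * \<bar>a - of_int h / of_int m\<bar> < of_int m * (1 / (of_int m)\<^sup>2)"
    by (intro mult_strict_left_mono) auto
  moreover have "\<bar>of_int m * a - of_int h\<bar> = of_int m * \<bar>a - of_int h / of_int m\<bar>"
    using m by (simp add: abs_mult_pos' right_diff_distrib)
  ultimately have "\<bar>of_int m * a - of_int h\<bar> < 1 / of_int m"
    using m by (simp add: power2_eq_square)
  also have "1 / of_int m < e"
  proof -
    have "1 / e < of_int m" using hm(2) by linarith
    with m \<open>e > 0\<close> show ?thesis by (simp add: field_simps)
  qed
  finally show ?thesis using hm(2) that by auto
qed

lemma irrational_orbit_meets_open:
  fixes a :: real
  assumes "a \<notin> \<rat>" "open U" "U \<noteq> {}"
  obtains p i where "of_int p * a + of_int i \<in> U"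
proof -
  obtain x e where "e > 0" and U: "ball x e \<subseteq> U"
    using assms(2,3) by (meson ex_in_conv openE)
  obtain h k where "\<bar>of_int k * a - of_int h - x\<bar> < e"
    using sequence_of_fractional_parts_is_dense[OF assms(1) \<open>e > 0\<close>] by metis
  then have "of_int k * a + of_int (- h) \<in> ball x e" by (simp add: dist_real_def)
  with U that show ?thesis by blast
qed

section \<open>From divergence to a dense orbit\<close>

text \<open>Topological transitivity in a strong form: by the intermediate value theorem the height
  change \<open>s\<close> is attained exactly. The integer \<open>i\<close> corrects the
  lift.\<close>

lemma cylindrical_hits_open:
  fixes a :: real and \<phi> :: "circle \<Rightarrow> real"
  defines "C \<equiv> \<lambda>n x. cocycle (to_circle a) \<phi> n (to_circle x)"
  assumes irr: "a \<notin> \<rat>" and cont: "continuous_on UNIV (\<lambda>x. \<phi> (to_circle x))"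
    and div: "\<And>M. \<exists>N. \<forall>n. \<bar>n\<bar> \<ge> N \<longrightarrow> C n 0 \<ge> M"
    and "open U" "U \<noteq> {}" "open V" "V \<noteq> {}"
  obtains x n i where "x \<in> U" "x + of_int n * a + of_int i \<in> V" "C n x = s"
proof -
  obtain p i1 where x1: "of_int p * a + of_int i1 \<in> U"
    using irrational_orbit_meets_open[OF irr \<open>open U\<close> \<open>U \<noteq> {}\<close>] by blast
  obtain q i2 where y1: "of_int q * a + of_int i2 \<in> V"
    using irrational_orbit_meets_open[OF irr \<open>open V\<close> \<open>V \<noteq> {}\<close>] by blast
  define x1 where "x1 = of_int p * a + of_int i1"
  define y1 where "y1 = of_int q * a + of_int i2"
  obtain e1 where e1: "e1 > 0" "ball x1 e1 \<subseteq> U" using x1 \<open>open U\<close> openE unfolding x1_def by blast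
  obtain e2 where e2: "e2 > 0" "ball y1 e2 \<subseteq> V" using y1 \<open>open V\<close> openE unfolding y1_def by blast
  obtain N1 where N1: "\<bar>n\<bar> \<ge> N1 \<Longrightarrow> C n 0 \<ge> C p 0 + s" for n using div by metis
  obtain N2 where N2: "\<bar>n\<bar> \<ge> N2 \<Longrightarrow> C n 0 \<ge> C q 0 - s" for n using div by metis
  \<comment> \<open>The size of \<open>m\<close> puts the times \<open>p + n = q + m\<close> and
    \<open>q - n = p - m\<close> beyond \<open>N1\<close> and \<open>N2\<close>, one forward and one
    backward; closeness of \<open>m a\<close> to \<open>h\<close> makes the drift \<open>d\<close>
    small.\<close>
  obtain h m where m: "m > \<bar>p\<bar> + \<bar>q\<bar> + \<bar>N1\<bar> + \<bar>N2\<bar>" and h: "\<bar>of_int m * a - of_int h\<bar> < min e1 e2"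
    using exists_large_return_time[OF irr, of "min e1 e2"] e1 e2 by (metis min_less_iff_conj)
  define d where "d = of_int m * a - of_int h"
  define n where "n = q - p + m"
  define i where "i = i2 - i1 - h"
  have shift: "x1 + of_int n * a + of_int i = y1 + d"
    by (simp add: x1_def y1_def d_def n_def i_def algebra_simps)
  have add: "C (j + k) x = C j x + C k (x + of_int j * a)" for j k x
    unfolding C_def by (rule cocycle_add)
  have per: "C j (x + of_int k) = C j x" for j x k
    unfolding C_def by simp
  have upper: "C n x1 \<ge> s"
  proof -
    have "C (p + n) 0 = C p 0 + C n x1" using add[of p n 0] by (simp add: x1_def per)
    moreover have "C (p + n) 0 \<ge> C p 0 + s" using m by (intro N1) (auto simp: n_def)
    ultimately show ?thesis by simp
  qed
  have lower: "C n (x1 - d) \<le> s"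
  proof -
    \<comment> \<open>Modulo 1, \<open>x1 - d\<close> is the point \<open>q a - n a\<close>. Going
      back from \<open>q a\<close> by \<open>n\<close> steps is a very negative time on the orbit of
      0, where divergence bounds the cocycle below.\<close>
    have *: "x1 - d + of_int n * a = of_int q * a + of_int (i1 + h)"
      by (simp add: x1_def d_def n_def algebra_simps)
    have "0 = C n (x1 - d) + C (- n) (of_int q * a)"
      using add[of n "- n" "x1 - d"] per unfolding * by (simp add: C_def del: of_int_add)
    moreover have "C (q - n) 0 = C q 0 + C (- n) (of_int q * a)" using add[of q "- n" 0] by simp
    moreover have "C (q - n) 0 \<ge> C q 0 - s" using m by (intro N2) (auto simp: n_def)
    ultimately show ?thesis by simp
  qed
  have "connected (C n ` closed_segment x1 (x1 - d))"
    unfolding C_def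
    by (intro connected_continuous_image continuous_on_subset[OF continuous_on_cocycle[OF cont]]) auto
  then have "s \<in> C n ` closed_segment x1 (x1 - d)"
    using upper lower by (meson connectedD_interval ends_in_segment imageI)
  then obtain x where x: "x \<in> closed_segment x1 (x1 - d)" "C n x = s" by blast
  \<comment> \<open>The point \<open>x\<close> lies between \<open>x1 - d\<close> and
    \<open>x1\<close>, so its image under the shift lies between \<open>y1\<close> and
    \<open>y1 + d\<close>.\<close>
  have "\<bar>x - x1\<bar> \<le> \<bar>d\<bar>" "\<bar>x + d - x1\<bar> \<le> \<bar>d\<bar>"
    using x(1) by (auto simp: closed_segment_eq_real_ivl split: if_splits)
  then have "x \<in> ball x1 e1" "x + of_int n * a + of_int i \<in> ball y1 e2"
    using h shift by (auto simp: dist_real_def d_def[symmetric])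
  with e1 e2 x(2) that show ?thesis by blast
qed

text \<open>Baire's theorem is applied on the real line to the base point alone; the starting height
  can be fixed at 0 because every height change is reached.\<close>

lemma dense_orbit_if_diverges:
  fixes a :: real
  assumes irr: "a \<notin> \<rat>" and cont: "continuous_on UNIV (\<lambda>x. \<phi> (to_circle x))"
    and div: "\<And>M. \<exists>N. \<forall>n. \<bar>n\<bar> \<ge> N \<longrightarrow> cocycle (to_circle a) \<phi> n (to_circle 0) \<ge> M"
  shows "\<exists>p. closure (orbit (cylindrical (to_circle a) \<phi>) p) = UNIV"
proof -
  define C where "C = (\<lambda>n x. cocycle (to_circle a) \<phi> n (to_circle x))"
  obtain B :: "real set set" where B: "countable B" "topological_basis B"
    using ex_countable_basis by blast
  \<comment> \<open>\<open>G (V, W)\<close> collects the base points whose orbit, started at height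
    0, visits \<open>V\<close> (modulo 1) at a height in \<open>W\<close>. A point in all these sets
    has a dense orbit.\<close>
  define G where "G = (\<lambda>(V, W). \<Union>n i. (\<lambda>x. x + of_int n * a + of_int i) -` V \<inter> C n -` W)"
  define P where "P = (B - {{}}) \<times> (B - {{}})"
  have openB: "open V" if "V \<in> B" for V
    using B(2) that by (rule topological_basis_open)
  have "UNIV \<subseteq> closure (\<Inter> (G ` P))"
  proof (rule Baire)
    show "countable (G ` P)" unfolding P_def using B(1) by blast
    fix T assume "T \<in> G ` P"
    then obtain V W where T: "T = G (V, W)" and VW: "V \<in> B" "V \<noteq> {}" "W \<in> B" "W \<noteq> {}"
      unfolding P_def by auto
    have "open T"
      unfolding T G_def C_def prod.case using VW
      by (intro open_UN ballI open_Int open_vimage openB continuous_on_cocycle cont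
          continuous_intros)
    moreover have "\<exists>y\<in>T. y \<in> U" if U: "open U" "U \<noteq> {}" for U
    proof -
      obtain s where "s \<in> W" using VW by blast
      obtain x n i where "x \<in> U" "x + of_int n * a + of_int i \<in> V" "C n x = s"
        using cylindrical_hits_open[OF irr cont div U openB[OF VW(1)] VW(2)] unfolding C_def by metis
      with \<open>s \<in> W\<close> show ?thesis unfolding T G_def by auto
    qed
    then have "UNIV \<subseteq> closure T"
      by (auto simp: closure_iff_nhds_not_empty) (metis IntI empty_iff subsetD)
    ultimately show "openin (top_of_set UNIV) T \<and> UNIV \<subseteq> closure T" by simp
  qed simp
  then obtain x where x: "x \<in> \<Inter> (G ` P)"
    by (metis UNIV_I closure_empty empty_iff ex_in_conv subset_iff)
  have "(c, t) \<in> closure (orbit (cylindrical (to_circle a) \<phi>) (to_circle x, 0))" for c t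
  proof -
    have "\<exists>z\<in>orbit (cylindrical (to_circle a) \<phi>) (to_circle x, 0). z \<in> S"
      if S: "open S" "(c, t) \<in> S" for S
    proof -
      obtain U W where UW: "open U" "open W" "c \<in> U" "t \<in> W" "U \<times> W \<subseteq> S"
        using S by (metis mem_Sigma_iff open_prod_elim)
      have "open (to_circle -` U)" "rep_circle c \<in> to_circle -` U"
        using UW by (simp_all add: open_circle_def[symmetric] to_circle_rep)
      then obtain V' where V': "V' \<in> B" "rep_circle c \<in> V'" "V' \<subseteq> to_circle -` U"
        by (rule topological_basisE[OF B(2)])
      obtain W' where W': "W' \<in> B" "t \<in> W'" "W' \<subseteq> W"
        using UW by (metis topological_basisE[OF B(2)])
      have "x \<in> G (V', W')" using x V' W' unfolding P_def by blast
      then obtain n i where n: "x + of_int n * a + of_int i \<in> V'" "C n x \<in> W'"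
        unfolding G_def by auto
      have "to_circle (x + of_int n * a) \<in> U"
        using n(1) V'(3) to_circle_add_of_int[of "x + of_int n * a" i] by auto
      then have "iterate (cylindrical (to_circle a) \<phi>) n (to_circle x, 0) \<in> S"
        using n(2) W'(3) UW(5) by (auto simp: iterate_cylindrical iterate_rotation C_def)
      then show ?thesis unfolding orbit_def by blast
    qed
    then show ?thesis unfolding closure_iff_nhds_not_empty by blast
  qed
  then have "closure (orbit (cylindrical (to_circle a) \<phi>) (to_circle x, 0)) = UNIV"
    by auto
  then show ?thesis by blast
qed

section \<open>Almost invariant functions that are large along the orbit\<close>

text \<open>Inf-convolution of the cost \<open>\<epsilon> \<bar>j\<bar>\<close> of travelling along the orbit with a steep cone of slope
  \<open>L\<close> on the circle: the first makes the function \<open>\<epsilon>\<close>-almost invariant under the rotation, the second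
  keeps it large at the orbit points \<open>na\<close> of long but bounded time.\<close>

definition transfer_fun :: "real \<Rightarrow> real \<Rightarrow> real \<Rightarrow> real \<Rightarrow> real" where
  "transfer_fun a \<epsilon> L x = (INF (j, i)\<in>UNIV. \<epsilon> * \<bar>of_int j\<bar> + L * \<bar>x - of_int j * a - of_int i\<bar>)"

lemma transfer_fun_le:
  assumes "\<epsilon> \<ge> 0" "L \<ge> 0"
  shows "transfer_fun a \<epsilon> L x \<le> \<epsilon> * \<bar>of_int j\<bar> + L * \<bar>x - of_int j * a - of_int i\<bar>"
  using assms unfolding transfer_fun_def
  by (intro cINF_lower2[where x = "(j, i)"] bdd_belowI[where m = 0]) auto

lemma transfer_fun_ge:
  assumes "\<And>j i. M \<le> \<epsilon> * \<bar>of_int j\<bar> + L * \<bar>x - of_int j * a - of_int i\<bar>"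
  shows "M \<le> transfer_fun a \<epsilon> L x"
  unfolding transfer_fun_def using assms by (intro cINF_greatest) auto

text \<open>Reindexing \<open>(j, i)\<close> to \<open>(j + s, i + r)\<close> turns a competitor at
  \<open>x\<close> into one at the shifted point. Special cases give periodicity, almost invariance
  under rotation and the Lipschitz bound.\<close>

lemma transfer_fun_shift_le:
  assumes "\<epsilon> \<ge> 0" "L \<ge> 0"
  shows "transfer_fun a \<epsilon> L (x + of_int s * a + of_int r + d) \<le>
    transfer_fun a \<epsilon> L x + \<epsilon> * \<bar>of_int s\<bar> + L * \<bar>d\<bar>"
proof -
  have "transfer_fun a \<epsilon> L (x + of_int s * a + of_int r + d) - \<epsilon> * \<bar>of_int s\<bar> - L * \<bar>d\<bar>
      \<le> transfer_fun a \<epsilon> L x"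
  proof (rule transfer_fun_ge)
    fix j i
    have "transfer_fun a \<epsilon> L (x + of_int s * a + of_int r + d) \<le> \<epsilon> * \<bar>of_int (j + s)\<bar> +
        L * \<bar>x + of_int s * a + of_int r + d - of_int (j + s) * a - of_int (i + r)\<bar>"
      by (rule transfer_fun_le[OF assms])
    also have "x + of_int s * a + of_int r + d - of_int (j + s) * a - of_int (i + r) =
        (x - of_int j * a - of_int i) + d"
      by (simp add: algebra_simps)
    also have "\<epsilon> * \<bar>of_int (j + s)\<bar> + L * \<bar>x - of_int j * a - of_int i + d\<bar> \<le>
        \<epsilon> * (\<bar>of_int j\<bar> + \<bar>of_int s\<bar>) + L * (\<bar>x - of_int j * a - of_int i\<bar> + \<bar>d\<bar>)"
      using assms by (intro add_mono mult_left_mono) auto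
    finally show "transfer_fun a \<epsilon> L (x + of_int s * a + of_int r + d) - \<epsilon> * \<bar>of_int s\<bar> - L * \<bar>d\<bar>
        \<le> \<epsilon> * \<bar>of_int j\<bar> + L * \<bar>x - of_int j * a - of_int i\<bar>"
      by (simp add: algebra_simps)
  qed
  then show ?thesis by simp
qed

lemma transfer_fun_0 [simp]:
  assumes "\<epsilon> \<ge> 0" "L \<ge> 0" shows "transfer_fun a \<epsilon> L 0 = 0"
proof (rule antisym)
  show "transfer_fun a \<epsilon> L 0 \<le> 0" using transfer_fun_le[OF assms, of a 0 0 0] by simp
  show "0 \<le> transfer_fun a \<epsilon> L 0" using assms by (intro transfer_fun_ge) auto
qed

lemma transfer_fun_add_of_int:
  assumes "\<epsilon> \<ge> 0" "L \<ge> 0" shows "transfer_fun a \<epsilon> L (x + of_int r) = transfer_fun a \<epsilon> L x"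
  using transfer_fun_shift_le[OF assms, of a x 0 r 0]
    transfer_fun_shift_le[OF assms, of a "x + of_int r" 0 "- r" 0] by simp

lemma transfer_fun_increment:
  assumes "\<epsilon> \<ge> 0" "L \<ge> 0" shows "\<bar>transfer_fun a \<epsilon> L (x + a) - transfer_fun a \<epsilon> L x\<bar> \<le> \<epsilon>"
  using transfer_fun_shift_le[OF assms, of a x 1 0 0]
    transfer_fun_shift_le[OF assms, of a "x + a" "-1" 0 0] by simp

lemma continuous_on_transfer_fun:
  assumes "\<epsilon> \<ge> 0" "L \<ge> 0" shows "continuous_on UNIV (transfer_fun a \<epsilon> L)"
proof (rule lipschitz_on_continuous_on[where L = L], rule lipschitz_onI)
  fix x y
  show "dist (transfer_fun a \<epsilon> L x) (transfer_fun a \<epsilon> L y) \<le> L * dist x y"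
    using transfer_fun_shift_le[OF assms, of a x 0 0 "y - x"]
      transfer_fun_shift_le[OF assms, of a y 0 0 "x - y"]
    by (simp add: dist_real_def abs_minus_commute abs_le_iff)
qed (use assms in auto)

text \<open>Only finitely many \<open>j\<close> occur, and irrationality keeps each
  \<open>j a\<close> with \<open>j \<noteq> 0\<close> at a positive distance from the
  integers.\<close>

lemma exists_steep_slope:
  fixes a M :: real
  assumes "a \<notin> \<rat>"
  obtains L where "L \<ge> 0" "\<And>j i. j \<noteq> 0 \<Longrightarrow> \<bar>j\<bar> \<le> R \<Longrightarrow> M \<le> L * \<bar>of_int j * a - of_int i\<bar>"
proof
  define D where "D j = \<bar>of_int j * a - of_int (round (of_int j * a))\<bar>" for j :: int
  \<comment> \<open>The sum dominates each of its nonnegative terms. The term at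
    \<open>j = 0\<close> is a division by zero, hence 0.\<close>
  define L where "L = (\<Sum>j\<in>{- R..R}. \<bar>M\<bar> / D j)"
  show "L \<ge> 0" unfolding L_def D_def by (intro sum_nonneg) auto
  fix j i :: int assume j: "j \<noteq> 0" "\<bar>j\<bar> \<le> R"
  have "D j \<noteq> 0"
  proof
    assume "D j = 0"
    then have "a = of_int (round (of_int j * a)) / of_int j"
      using j by (simp add: D_def field_simps)
    with assms show False by (metis Rats_divide Rats_of_int)
  qed
  then have D: "D j > 0" by (simp add: D_def)
  have "\<bar>M\<bar> / D j \<le> L"
    unfolding L_def by (intro member_le_sum) (use j in \<open>auto simp: D_def\<close>)
  then have "\<bar>M\<bar> \<le> L * D j" using D by (simp add: field_simps)
  also have "\<dots> \<le> L * \<bar>of_int j * a - of_int i\<bar>"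
    using \<open>L \<ge> 0\<close> unfolding D_def by (intro mult_left_mono round_diff_minimal)
  finally show "M \<le> L * \<bar>of_int j * a - of_int i\<bar>" by simp
qed

text \<open>Either \<open>j\<close> is so long that travelling alone costs \<open>M\<close>, or
  \<open>j\<close> is shorter than \<open>n\<close>; then \<open>n - j\<close> is nonzero and
  bounded, and the steep cone costs \<open>M\<close>.\<close>

lemma exists_large_transfer_fun:
  fixes a M :: real
  assumes "a \<notin> \<rat>" "\<epsilon> > 0"
  obtains L where "L \<ge> 0"
    "\<And>n. M / \<epsilon> \<le> \<bar>of_int n\<bar> \<Longrightarrow> \<bar>n\<bar> \<le> R \<Longrightarrow> M \<le> transfer_fun a \<epsilon> L (of_int n * a)"
proof -
  obtain L where L: "L \<ge> 0"
    "\<And>j i. j \<noteq> 0 \<Longrightarrow> \<bar>j\<bar> \<le> \<bar>R\<bar> + \<lceil>\<bar>M\<bar> / \<epsilon>\<rceil> \<Longrightarrow> M \<le> L * \<bar>of_int j * a - of_int i\<bar>"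
    using exists_steep_slope[OF assms(1), of "\<bar>R\<bar> + \<lceil>\<bar>M\<bar> / \<epsilon>\<rceil>" M] by metis
  show thesis
  proof (rule that[OF L(1)])
    fix n :: int assume n: "M / \<epsilon> \<le> \<bar>of_int n\<bar>" "\<bar>n\<bar> \<le> R"
    show "M \<le> transfer_fun a \<epsilon> L (of_int n * a)"
    proof (rule transfer_fun_ge)
      fix j i :: int
      have nonneg: "0 \<le> \<epsilon> * \<bar>of_int j\<bar>" "0 \<le> L * \<bar>of_int n * a - of_int j * a - of_int i\<bar>"
        using \<open>\<epsilon> > 0\<close> L(1) by auto
      show "M \<le> \<epsilon> * \<bar>of_int j\<bar> + L * \<bar>of_int n * a - of_int j * a - of_int i\<bar>"
      proof (cases "M / \<epsilon> \<le> \<bar>of_int j\<bar>")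
        case True
        then have "M \<le> \<epsilon> * \<bar>of_int j\<bar>" using \<open>\<epsilon> > 0\<close> by (simp add: field_simps)
        with nonneg show ?thesis by simp
      next
        case False
        have "\<bar>of_int j\<bar> \<le> \<bar>M\<bar> / \<epsilon>"
          using False \<open>\<epsilon> > 0\<close> by (smt (verit) divide_right_mono)
        then have "\<bar>j\<bar> \<le> \<lceil>\<bar>M\<bar> / \<epsilon>\<rceil>" by linarith
        then have "\<bar>n - j\<bar> \<le> \<bar>R\<bar> + \<lceil>\<bar>M\<bar> / \<epsilon>\<rceil>" using n(2) by linarith
        moreover have "n - j \<noteq> 0" using n(1) False by auto
        ultimately have "M \<le> L * \<bar>of_int (n - j) * a - of_int i\<bar>" by (intro L(2))
        with nonneg(1) show ?thesis by (simp add: algebra_simps)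
      qed
    qed
  qed
qed

section \<open>Summing the coboundaries\<close>

lemma exists_diverging_cocycle:
  fixes a :: real
  assumes irr: "a \<notin> \<rat>"
  obtains \<phi> where "continuous_on UNIV (\<lambda>x. \<phi> (to_circle x))"
    "\<And>M. \<exists>N. \<forall>n. \<bar>n\<bar> \<ge> N \<longrightarrow> cocycle (to_circle a) \<phi> n (to_circle 0) \<ge> M"
proof -
  \<comment> \<open>\<open>N k\<close> is \<open>k\<close> divided by the step cost
    \<open>(1/2) ^ k\<close>: the time from which travel can cost \<open>k\<close>.\<close>
  define N where "N k = int k * 2 ^ k" for k :: nat
  have "\<exists>L\<ge>0. \<forall>n. N k \<le> \<bar>n\<bar> \<longrightarrow> \<bar>n\<bar> \<le> N (Suc k) \<longrightarrow>
      real k \<le> transfer_fun a ((1/2) ^ k) L (of_int n * a)" for k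
  proof -
    obtain L where L: "L \<ge> 0" "\<And>n. real k / (1/2) ^ k \<le> \<bar>of_int n\<bar> \<Longrightarrow> \<bar>n\<bar> \<le> N (Suc k) \<Longrightarrow>
        real k \<le> transfer_fun a ((1/2) ^ k) L (of_int n * a)"
      using exists_large_transfer_fun[OF irr, of "(1/2) ^ k" "real k" "N (Suc k)"] by auto
    have "real k / (1/2) ^ k \<le> \<bar>of_int n\<bar>" if "N k \<le> \<bar>n\<bar>" for n
    proof -
      have "real_of_int (N k) \<le> of_int \<bar>n\<bar>" using that by (simp only: of_int_le_iff)
      then show ?thesis by (simp add: N_def power_divide)
    qed
    with L show ?thesis by blast
  qed
  then obtain L where L0: "\<And>k. L k \<ge> 0" and
    L: "\<And>k n. N k \<le> \<bar>n\<bar> \<Longrightarrow> \<bar>n\<bar> \<le> N (Suc k) \<Longrightarrow>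
      real k \<le> transfer_fun a ((1/2) ^ k) (L k) (of_int n * a)"
    by metis
  define h where "h k = transfer_fun a ((1/2) ^ k) (L k)" for k
  define f where "f x = (\<Sum>k. h k (x + a) - h k x)" for x
  define \<phi> where "\<phi> c = f (rep_circle c)" for c
  have incr: "norm (h k (x + a) - h k x) \<le> (1/2) ^ k" for k x
    using transfer_fun_increment[of "(1/2) ^ k" "L k" a x] L0 by (simp add: h_def)
  have summ: "summable (\<lambda>k. h k (x + a) - h k x)" for x
    by (rule summable_comparison_test'[where g = "\<lambda>k. (1/2) ^ k" and N = 0]) (use incr in auto)
  have h_cont: "continuous_on UNIV (h k)" for k
    unfolding h_def by (rule continuous_on_transfer_fun) (use L0 in auto)
  have h_per: "h k (x + of_int r) = h k x" for k x r
    unfolding h_def by (rule transfer_fun_add_of_int) (use L0 in auto)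
  have h_nonneg: "0 \<le> h k x" for k x
    unfolding h_def by (rule transfer_fun_ge) (use L0 in auto)
  \<comment> \<open>Periodicity of \<open>f\<close> makes \<open>\<phi>\<close> independent of the
    chosen representative.\<close>
  have "f (x + of_int r) = f x" for x r
    using h_per[of _ "x + a" r] by (simp add: f_def h_per algebra_simps)
  moreover have "\<exists>r. rep_circle (to_circle x) = x + of_int r" for x
    using to_circle_rep[of "to_circle x"] unfolding to_circle_eq_iff
    by (metis Ints_cases add_diff_cancel_left' diff_add_cancel add.commute)
  ultimately have \<phi>: "\<phi> (to_circle x) = f x" for x
    unfolding \<phi>_def by metis
  have "continuous_on UNIV f"
  proof (rule uniform_limit_theorem)
    show "uniform_limit UNIV (\<lambda>n x. \<Sum>k<n. h k (x + a) - h k x) f sequentially"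
      unfolding f_def using incr by (rule Weierstrass_m_test) simp
    have "continuous_on UNIV (\<lambda>x. h k (x + a))" for k
      by (rule continuous_on_compose2[OF h_cont]) (auto intro!: continuous_intros)
    then show "\<forall>\<^sub>F n in sequentially. continuous_on UNIV (\<lambda>x. \<Sum>k<n. h k (x + a) - h k x)"
      by (intro always_eventually allI continuous_on_sum continuous_on_diff h_cont)
  qed simp
  moreover have "\<exists>N. \<forall>n. \<bar>n\<bar> \<ge> N \<longrightarrow> cocycle (to_circle a) \<phi> n (to_circle 0) \<ge> M" for M
  proof -
    have step: "h k (of_int (n + 1) * a) - h k (of_int n * a) =
        h k (of_int n * a + a) - h k (of_int n * a)" for k n
      by (simp add: algebra_simps)
    have h0: "h k 0 = 0" for k using L0 by (simp add: h_def)
    \<comment> \<open>The \<open>h k\<close> have no summable bound on the whole line. Along the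
      orbit of 0, however, the series vanishes at time 0 and each step changes it by a summable
      series.\<close>
    have hs: "summable (\<lambda>k. h k (of_int n * a))" for n
    proof (induction n rule: int_induct[where k = 0])
      case (step1 i)
      have "summable (\<lambda>k. h k (of_int i * a) + (h k (of_int i * a + a) - h k (of_int i * a)))"
        using step1(2) summ by (rule summable_add)
      then show ?case by (simp add: algebra_simps)
    next
      case (step2 i)
      have "summable (\<lambda>k. h k (of_int i * a) -
          (h k (of_int (i - 1) * a + a) - h k (of_int (i - 1) * a)))"
        using step2(2) summ by (rule summable_diff)
      then show ?case by (simp add: algebra_simps)
    qed (simp add: h0)
    have C: "cocycle (to_circle a) \<phi> n (to_circle 0) = (\<Sum>k. h k (of_int n * a))" for n
    proof (rule cocycle_unique)
      fix n
      have "(\<Sum>k. h k (of_int (n + 1) * a)) - (\<Sum>k. h k (of_int n * a)) = f (of_int n * a)"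
        unfolding f_def step[symmetric] using hs by (intro suminf_diff)
      then show "(\<Sum>k. h k (of_int (n + 1) * a)) =
          (\<Sum>k. h k (of_int n * a)) + \<phi> (to_circle (0 + of_int n * a))"
        by (simp add: \<phi>)
    qed (simp add: h0)
    have "M \<le> cocycle (to_circle a) \<phi> n (to_circle 0)" if n: "N (nat \<lceil>M\<rceil>) \<le> \<bar>n\<bar>" for n
    proof -
      let ?P = "\<lambda>k. N k \<le> \<bar>n\<bar>"
      have bound: "k \<le> nat \<bar>n\<bar>" if "?P k" for k
      proof -
        have "int k * 1 \<le> int k * 2 ^ k" by (intro mult_left_mono) auto
        with that show ?thesis unfolding N_def by linarith
      qed
      \<comment> \<open>The greatest \<open>k\<close> with \<open>N k \<le> \<bar>n\<bar>\<close>
        selects the window containing \<open>n\<close>; it exists since \<open>k \<le> N k\<close>.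
        By nonnegativity the single term \<open>h k\<close> bounds the whole sum from below.\<close>
      define k where "k = Greatest ?P"
      have "?P k" unfolding k_def using n bound by (intro GreatestI_nat[where P = ?P]) auto
      have "nat \<lceil>M\<rceil> \<le> k" unfolding k_def using n bound by (intro Greatest_le_nat[where P = ?P]) auto
      have "\<not> ?P (Suc k)"
        using Greatest_le_nat[where P = ?P, OF _ bound] unfolding k_def by (metis Suc_n_not_le_n)
      then have "real k \<le> h k (of_int n * a)"
        unfolding h_def using \<open>?P k\<close> by (intro L) auto
      also have "\<dots> \<le> (\<Sum>k. h k (of_int n * a))"
        using sum_le_suminf[OF hs, of "{k}"] h_nonneg by simp
      finally show ?thesis using \<open>nat \<lceil>M\<rceil> \<le> k\<close> unfolding C by linarith
    qed
    then show ?thesis by blast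
  qed
  ultimately show ?thesis using that[of \<phi>] by (simp add: \<phi>)
qed

theorem mainTheorem1:
  fixes \<alpha> :: circle
  assumes "irrational_circle \<alpha>"
  shows "\<exists>\<phi> :: circle \<Rightarrow> real. continuous_on UNIV \<phi> \<and> besicovitch \<alpha> \<phi>"
proof -
  define a where "a = rep_circle \<alpha>"
  have \<alpha>: "\<alpha> = to_circle a" by (simp add: a_def to_circle_rep)
  with assms have irr: "a \<notin> \<rat>" by (simp add: irrational_circle_to_circle_iff)
  obtain \<phi> where cont: "continuous_on UNIV (\<lambda>x. \<phi> (to_circle x))"
    and div: "\<And>M. \<exists>N. \<forall>n. \<bar>n\<bar> \<ge> N \<longrightarrow> cocycle \<alpha> \<phi> n (to_circle 0) \<ge> M"
    using exists_diverging_cocycle[OF irr] unfolding \<alpha> by blast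
  \<comment> \<open>The circle carries the quotient topology, so continuity can be tested on the
    lift.\<close>
  have "continuous_on UNIV \<phi>"
    using cont by (simp add: continuous_on_open_vimage open_circle_def vimage_def)
  moreover have "discrete_orbit \<alpha> \<phi> (to_circle 0, 0)"
    unfolding discrete_orbit_def filterlim_at_top eventually_filtercomap
  proof
    fix M
    obtain N where N: "\<forall>n. \<bar>n\<bar> \<ge> N \<longrightarrow> cocycle \<alpha> \<phi> n (to_circle 0) \<ge> M"
      using div by blast
    have "eventually (\<lambda>n. N \<le> n) at_top" by (rule eventually_ge_at_top)
    with N show "\<exists>Q. eventually Q at_top \<and>
        (\<forall>n. Q \<bar>n\<bar> \<longrightarrow> M \<le> \<bar>cocycle \<alpha> \<phi> n (fst (to_circle 0, 0))\<bar>)"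
      by (intro exI[of _ "\<lambda>n. N \<le> n"]) (auto intro: order_trans[OF _ abs_ge_self])
  qed
  moreover have "\<exists>p. closure (orbit (cylindrical \<alpha> \<phi>) p) = UNIV"
    using dense_orbit_if_diverges[OF irr cont] div unfolding \<alpha> by blast
  ultimately show ?thesis unfolding besicovitch_def by blast
qed

end
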